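(* There exists a matrix $\mathbf{G}\in\mathbb{R}^{5\times5}$ which satisfies $\langle \mathbf{G},\operatorname{polar}(\operatorname{sign}(\mathbf{G}))\rangle\approx-13.89<0$ (the value rounds to $-13.89$ at two decimals) and, for this same $\mathbf{G}$, $$\bigl\langle \mathbf{G},\operatorname{sign}(\operatorname{polar}(\operatorname{sign}(\mathbf{G})))\bigr\rangle=-76<0 .$$ Consequently MuonSign ascends on the linear objective $f(\mathbf{X})=\langle\mathbf{G},\mathbf{X}\rangle=\operatorname{Tr}(\mathbf{G}^\top\mathbf{X})$ on $\mathbb{R}^{5\times5}$: for every starting point $\mathbf{X}_0$, every sequence of step sizes $\eta_t>0$, every momentum coefficient $\mu\in[0,1)$ and both momentum variants (standard and Nesterov), $f(\mathbf{X}_t)>f(\mathbf{X}_{t-1})$ for every $t\ge1$.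
   Context: $\langle\mathbf{A},\mathbf{B}\rangle=\sum_{i,j}A_{ij}B_{ij}$. For a matrix $\mathbf{M}$ of rank $r$ with thin singular value decomposition $\mathbf{M}=\mathbf{U}\boldsymbol{\Sigma}\mathbf{V}^\top$ ($\mathbf{U},\mathbf{V}$ with $r$ orthonormal columns, one per nonzero singular value), $\operatorname{polar}(\mathbf{M}):=\mathbf{U}\mathbf{V}^\top$. The function $\operatorname{sign}(\cdot)$ acts entrywise with values in $\{\pm1\}$; an exact zero is resolved to an arbitrary (random) $\pm1$, and assertions about signs are to hold for every such resolution. MuonSign with exact gradients: $\mathbf{M}_0=\mathbf{0}$ and, for $t\ge1$, $\mathbf{G}_t=\nabla f(\mathbf{X}_{t-1})$, $\mathbf{M}_t=\mu\mathbf{M}_{t-1}+(1-\mu)\mathbf{G}_t$; $\tilde{\mathbf{M}}_t=\mathbf{M}_t$ (standard) or $\tilde{\mathbf{M}}_t=(1-\mu)\mathbf{G}_t+\mu\mathbf{M}_t$ (Nesterov); $\mathbf{s}_t=\operatorname{sign}(\operatorname{polar}(\operatorname{sign}(\tilde{\mathbf{M}}_t)))$; $\mathbf{X}_t=\mathbf{X}_{t-1}-\eta_t\mathbf{s}_t$. *)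

theory Defs
  imports "HOL-Analysis.Analysis"
begin

(* A matrix with rows indexed by 'm and columns by 'n has type real^'n^'m.  On this type the
   library inner product is the Frobenius inner product: *)
lemma inner_matrix_eq_sum:
  fixes A B :: "real^'n^'m"
  shows "A \<bullet> B = (\<Sum>i\<in>UNIV. \<Sum>j\<in>UNIV. A $ i $ j * B $ i $ j)"
  by (simp add: inner_vec_def)

(* M = U Sigma V^T, where r is the rank of M, U has columns u 0, ..., u (r-1), V has columns
   v 0, ..., v (r-1), and Sigma is diagonal with positive entries sg 0, ..., sg (r-1).  The number
   of columns depends on M, so the columns are indexed by natural numbers below r. *)
definition thin_svd ::
  "real^'n^'m \<Rightarrow> nat \<Rightarrow> (nat \<Rightarrow> real^'m) \<Rightarrow> (nat \<Rightarrow> real) \<Rightarrow> (nat \<Rightarrow> real^'n) \<Rightarrow> bool" where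
  "thin_svd M r u sg v \<longleftrightarrow>
     r = rank M \<and>
     (\<forall>k<r. \<forall>l<r. u k \<bullet> u l = (if k = l then 1 else 0)) \<and>
     (\<forall>k<r. \<forall>l<r. v k \<bullet> v l = (if k = l then 1 else 0)) \<and>
     (\<forall>k<r. sg k > 0) \<and>
     M = (\<chi> i j. \<Sum>k<r. u k $ i * sg k * v k $ j)"

(* The matrix U V^T is the same for all thin singular value decompositions of M. *)
definition polar :: "real^'n^'m \<Rightarrow> real^'n^'m" where
  "polar M = (THE P. \<exists>r u sg v. thin_svd M r u sg v \<and> P = (\<chi> i j. \<Sum>k<r. u k $ i * v k $ j))"

(* S is a possible value of the entrywise sign of M: where M has an exact zero, S may have
   either of the entries 1 and -1. *)
definition is_sign :: "real^'n^'m \<Rightarrow> real^'n^'m \<Rightarrow> bool" where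
  "is_sign M S \<longleftrightarrow>
     (\<forall>i j. S $ i $ j \<in> {1, -1} \<and>
        (M $ i $ j > 0 \<longrightarrow> S $ i $ j = 1) \<and> (M $ i $ j < 0 \<longrightarrow> S $ i $ j = -1))"

datatype momentum_variant = Standard | Nesterov

(* X is a run of MuonSign with exact gradients started at X0.  The signs are resolved
   arbitrarily at each step, so the same data may admit several runs. *)
definition muon_sign_run ::
  "momentum_variant \<Rightarrow> (real^'n^'m \<Rightarrow> real) \<Rightarrow> real \<Rightarrow> (nat \<Rightarrow> real) \<Rightarrow> real^'n^'m
     \<Rightarrow> (nat \<Rightarrow> real^'n^'m) \<Rightarrow> bool" where
  "muon_sign_run variant f \<mu> \<eta> X0 X \<longleftrightarrow>
     X 0 = X0 \<and>
     (\<exists>G M Mt S s.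
        M 0 = 0 \<and>
        (\<forall>t\<ge>1.
           (GDERIV f (X (t - 1)) :> G t) \<and>
           M t = \<mu> *\<^sub>R M (t - 1) + (1 - \<mu>) *\<^sub>R G t \<and>
           Mt t = (case variant of
                     Standard \<Rightarrow> M t
                   | Nesterov \<Rightarrow> (1 - \<mu>) *\<^sub>R G t + \<mu> *\<^sub>R M t) \<and>
           is_sign (Mt t) (S t) \<and>
           is_sign (polar (S t)) (s t) \<and>
           X t = X (t - 1) - \<eta> t *\<^sub>R s t))"

end

theory Submission
  imports Defs
begin

text \<open>The sign of a polar factor can disagree with the sign of the matrix itself, and weight put on
  an entry where it does costs the linear objective.  The sign pattern used here is the symmetric
  matrix \<open>S\<close> with all entries \<open>1\<close>, except that four of its five diagonal entries are \<open>-1\<close>; call the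
  remaining diagonal entry the corner.

  The polar factor of an invertible symmetric matrix is its matrix sign function: it has the same
  eigenvectors, and each eigenvalue is replaced by its sign (\<open>polar_eqI_eigenbasis\<close>).  On vectors
  that vanish at the corner and sum to zero, \<open>S\<close> acts as \<open>-2\<close>.  On the plane spanned by the corner
  axis and the normalised all-ones vector of the other four axes it acts as the matrix \<open>A\<close> with
  rows \<open>(1, 2)\<close> and \<open>(2, 2)\<close>, whose eigenvalues \<open>(3 \<plusminus> \<surd>17) / 2\<close> have opposite signs; so its sign
  function is \<open>(2 A - 3 I) / \<surd>17\<close>.  The corner entry of that is \<open>(2 - 3) / \<surd>17 < 0\<close>, although the
  corner of \<open>S\<close> is \<open>1\<close>.  All other entries of the polar factor keep the sign they have in \<open>S\<close>
  (\<open>polar_bordered\<close>).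

  Let \<open>G\<close> be \<open>S\<close> with its corner raised to \<open>100\<close>.  Then \<open>sign G = S\<close>, the inner product of \<open>G\<close> with
  the polar factor is \<open>6 - 82 / \<surd>17\<close>, about \<open>-13.888\<close>, and the inner product with the signs of the
  polar factor is \<open>-100 + 24 = -76\<close>.  No entry of \<open>G\<close> or of the polar factor is zero, so the signs
  are unambiguous.

  For MuonSign on a linear objective the momentum after the first gradient is a positive multiple of
  \<open>G\<close>, so each step
  changes the objective by \<open>76\<close> times the step size (\<open>muon_sign_run_ascends\<close>).

  All this needs that \<open>U V\<^sup>T\<close> does not depend on the singular value decomposition (\<open>polar_eq\<close>).  The
  singular vectors are not unique, but passing between two decompositions transforms the left and
  the right singular vectors by the same orthogonal matrix, which cancels in \<open>U V\<^sup>T\<close>.\<close>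

section \<open>The polar factor is well defined\<close>

lemma thin_svdD:
  assumes "thin_svd M r u sg v"
  shows "r = rank M"
    and "\<And>k l. k < r \<Longrightarrow> l < r \<Longrightarrow> u k \<bullet> u l = (if k = l then 1 else 0)"
    and "\<And>k l. k < r \<Longrightarrow> l < r \<Longrightarrow> v k \<bullet> v l = (if k = l then 1 else 0)"
    and "\<And>k. k < r \<Longrightarrow> sg k > 0"
    and "M = (\<chi> i j. \<Sum>k<r. u k $ i * sg k * v k $ j)"
  using assms unfolding thin_svd_def by blast+

lemma thin_svd_transpose:
  assumes "thin_svd M r u sg v"
  shows "thin_svd (transpose M) r v sg u"
proof -
  have "transpose M = transpose (\<chi> i j. \<Sum>k<r. u k $ i * sg k * v k $ j)"
    by (rule arg_cong[OF thin_svdD(5)[OF assms]])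
  also have "\<dots> = (\<chi> i j. \<Sum>k<r. v k $ i * sg k * u k $ j)"
    by (simp add: transpose_def vec_eq_iff mult_ac)
  finally show ?thesis
    using assms unfolding thin_svd_def rank_transpose by blast
qed

lemma thin_svd_mult_vec:
  assumes "thin_svd M r u sg v"
  shows "M *v x = (\<Sum>k<r. (sg k * (v k \<bullet> x)) *\<^sub>R u k)"
proof -
  have "(M *v x) $ i = (\<Sum>k<r. (sg k * (v k \<bullet> x)) *\<^sub>R u k) $ i" for i
  proof -
    have "(M *v x) $ i = (\<Sum>j\<in>UNIV. \<Sum>k<r. u k $ i * sg k * v k $ j * x $ j)"
      by (subst thin_svdD(5)[OF assms]) (simp add: matrix_vector_mult_def sum_distrib_right)
    also have "\<dots> = (\<Sum>k<r. \<Sum>j\<in>UNIV. u k $ i * sg k * v k $ j * x $ j)"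
      by (rule sum.swap)
    also have "\<dots> = (\<Sum>k<r. (sg k * (v k \<bullet> x)) *\<^sub>R u k) $ i"
      by (simp add: inner_vec_def sum_distrib_left sum_distrib_right mult_ac)
    finally show ?thesis .
  qed
  then show ?thesis by (simp add: vec_eq_iff)
qed

lemma thin_svd_right_vector:
  assumes svd: "thin_svd M r u sg v" and "l < r"
  shows "M *v v l = sg l *\<^sub>R u l"
proof -
  have "M *v v l = (\<Sum>k<r. if k = l then sg l *\<^sub>R u l else 0)"
    unfolding thin_svd_mult_vec[OF svd]
    using \<open>l < r\<close> by (intro sum.cong) (auto simp: thin_svdD(3)[OF svd])
  with \<open>l < r\<close> show ?thesis by simp
qed

text \<open>Both sides are the inner product of \<open>u' k\<close> with \<open>M *v v l\<close>, evaluated with one decomposition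
  and with the other.\<close>

lemma thin_svd_cross:
  assumes svd: "thin_svd M r u sg v" and svd': "thin_svd M r u' sg' v'"
    and "k < r" "l < r"
  shows "sg' k * (v' k \<bullet> v l) = sg l * (u' k \<bullet> u l)"
proof -
  have "u' k \<bullet> (M *v v l) = (\<Sum>m<r. if m = k then sg' k * (v' k \<bullet> v l) else 0)"
    unfolding thin_svd_mult_vec[OF svd'] inner_sum_right
    using \<open>k < r\<close> by (intro sum.cong) (auto simp: thin_svdD(2)[OF svd'])
  with \<open>k < r\<close> show ?thesis
    by (simp add: thin_svd_right_vector[OF svd \<open>l < r\<close>])
qed

text \<open>Writing \<open>a\<close> and \<open>b\<close> for the two inner products, the relation between two decompositions
  and its transpose say \<open>\<sigma>' a = \<sigma> b\<close> and \<open>\<sigma>' b = \<sigma> a\<close>; subtracting them gives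
  \<open>(\<sigma>' + \<sigma>) (a - b) = 0\<close>, and singular values are positive.  So the left vectors of one
  decomposition have the same coordinates in the other as the right vectors have.\<close>

lemma thin_svd_coordinates_eq:
  assumes svd: "thin_svd M r u sg v" and svd': "thin_svd M r u' sg' v'"
    and kl: "k < r" "l < r"
  shows "v' k \<bullet> v l = u' k \<bullet> u l"
proof -
  have "sg' k * (v' k \<bullet> v l) = sg l * (u' k \<bullet> u l)"
    by (rule thin_svd_cross[OF svd svd' kl])
  moreover have "sg' k * (u' k \<bullet> u l) = sg l * (v' k \<bullet> v l)"
    by (rule thin_svd_cross[OF thin_svd_transpose[OF svd] thin_svd_transpose[OF svd'] kl])
  ultimately have "(sg' k + sg l) * (v' k \<bullet> v l - u' k \<bullet> u l) = 0"
    by (simp add: algebra_simps)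
  moreover have "sg' k > 0" "sg l > 0"
    using thin_svdD(4)[OF svd'] thin_svdD(4)[OF svd] kl by auto
  ultimately show ?thesis by auto
qed

text \<open>A left singular vector \<open>u l\<close> is a multiple of \<open>M *v v l\<close>, hence lies in the range of \<open>M\<close>, which
  the left vectors of any decomposition span.\<close>

lemma thin_svd_left_vector_expand:
  assumes svd: "thin_svd M r u sg v" and svd': "thin_svd M r u' sg' v'" and "l < r"
  shows "u l = (\<Sum>k<r. (u' k \<bullet> u l) *\<^sub>R u' k)"
proof -
  have "sg l *\<^sub>R u l = M *v v l"
    by (simp add: thin_svd_right_vector[OF svd \<open>l < r\<close>])
  also have "\<dots> = (\<Sum>k<r. (sg l * (u' k \<bullet> u l)) *\<^sub>R u' k)"
    unfolding thin_svd_mult_vec[OF svd']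
    using thin_svd_cross[OF svd svd' _ \<open>l < r\<close>] by (intro sum.cong) auto
  also have "\<dots> = sg l *\<^sub>R (\<Sum>k<r. (u' k \<bullet> u l) *\<^sub>R u' k)"
    by (simp add: scaleR_sum_right)
  finally show ?thesis
    using thin_svdD(4)[OF svd \<open>l < r\<close>] by simp
qed

text \<open>Expanding each \<open>u l\<close> in the \<open>u' k\<close> introduces the coefficients \<open>u' k \<bullet> u l\<close>, which are also
  \<open>v' k \<bullet> v l\<close>.  Regrouped by \<open>k\<close>, they are the coefficients that expand \<open>v' k\<close> in the \<open>v l\<close>.\<close>

lemma thin_svd_polar_unique:
  assumes svd: "thin_svd M r u sg v" and svd': "thin_svd M r u' sg' v'"
  shows "(\<Sum>l<r. u l $ i * v l $ j) = (\<Sum>k<r. u' k $ i * v' k $ j)"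
proof -
  have "(\<Sum>l<r. u l $ i * v l $ j) = (\<Sum>l<r. (\<Sum>k<r. (u' k \<bullet> u l) * u' k $ i) * v l $ j)"
  proof (intro sum.cong refl)
    fix l assume "l \<in> {..<r}"
    then have "u l $ i = (\<Sum>k<r. (u' k \<bullet> u l) *\<^sub>R u' k) $ i"
      using thin_svd_left_vector_expand[OF svd svd', of l] by simp
    then show "u l $ i * v l $ j = (\<Sum>k<r. (u' k \<bullet> u l) * u' k $ i) * v l $ j"
      by simp
  qed
  also have "\<dots> = (\<Sum>l<r. \<Sum>k<r. u' k $ i * ((v l \<bullet> v' k) * v l $ j))"
    unfolding sum_distrib_right
    by (intro sum.cong refl)
       (simp add: thin_svd_coordinates_eq[OF svd svd', symmetric] inner_commute[of "v _"])
  also have "\<dots> = (\<Sum>k<r. u' k $ i * (\<Sum>l<r. (v l \<bullet> v' k) *\<^sub>R v l) $ j)"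
    by (subst sum.swap) (simp add: sum_distrib_left)
  also have "\<dots> = (\<Sum>k<r. u' k $ i * v' k $ j)"
    \<comment> \<open>Left vectors of the transpose are right vectors of the matrix, and here \<open>v'\<close> is expanded in \<open>v\<close>.\<close>
    by (intro sum.cong refl arg_cong2[where f = "(*)"])
       (simp add: thin_svd_left_vector_expand
          [OF thin_svd_transpose[OF svd'] thin_svd_transpose[OF svd], symmetric])
  finally show ?thesis .
qed

lemma polar_eq:
  assumes svd: "thin_svd M r u sg v"
  shows "polar M = (\<chi> i j. \<Sum>k<r. u k $ i * v k $ j)"
  unfolding polar_def
proof (rule the_equality)
  show "\<exists>r' u' sg' v'. thin_svd M r' u' sg' v' \<and>
    (\<chi> i j. \<Sum>k<r. u k $ i * v k $ j) = (\<chi> i j. \<Sum>k<r'. u' k $ i * v' k $ j)"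
    using svd by blast
next
  fix P
  assume "\<exists>r' u' sg' v'. thin_svd M r' u' sg' v' \<and> P = (\<chi> i j. \<Sum>k<r'. u' k $ i * v' k $ j)"
  then obtain r' u' sg' v' where svd': "thin_svd M r' u' sg' v'"
    and P: "P = (\<chi> i j. \<Sum>k<r'. u' k $ i * v' k $ j)"
    by blast
  have "r' = r"
    using thin_svdD(1)[OF svd] thin_svdD(1)[OF svd'] by simp
  with svd' P show "P = (\<chi> i j. \<Sum>k<r. u k $ i * v k $ j)"
    using thin_svd_polar_unique[OF svd] by (simp add: vec_eq_iff)
qed

section \<open>The polar factor from an orthogonal eigenbasis\<close>

lemma orthonormal_family_expand:
  fixes e :: "nat \<Rightarrow> real^'n"
  assumes on: "\<And>k l. k < CARD('n) \<Longrightarrow> l < CARD('n) \<Longrightarrow> e k \<bullet> e l = (if k = l then 1 else 0)"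
  shows "x = (\<Sum>k<CARD('n). (e k \<bullet> x) *\<^sub>R e k)"
proof -
  let ?B = "e ` {..<CARD('n)}"
  have inj: "inj_on e {..<CARD('n)}"
    using on by (metis inj_onI lessThan_iff zero_neq_one)
  have orth: "pairwise orthogonal ?B"
    using on by (auto simp: pairwise_def orthogonal_def)
  have nz: "0 \<notin> ?B"
    using on by (metis imageE inner_zero_left lessThan_iff zero_neq_one)
  have "independent ?B"
    by (rule pairwise_orthogonal_independent[OF orth nz])
  then have "x \<in> span ?B"
    using card_ge_dim_independent[of ?B UNIV] inj by (auto simp: card_image)
  moreover have "norm b = 1" if "b \<in> ?B" for b
    using that on by (auto simp: norm_eq_sqrt_inner)
  ultimately have "x = (\<Sum>b\<in>?B. (b \<bullet> x) *\<^sub>R b)"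
    using orthonormal_basis_expand[OF orth, of x] by (simp add: inner_commute)
  then show ?thesis
    by (simp add: sum.reindex[OF inj])
qed

lemma matrix_eq_sum_orthonormal_family:
  fixes A :: "real^'n^'m" and e :: "nat \<Rightarrow> real^'n"
  assumes on: "\<And>k l. k < CARD('n) \<Longrightarrow> l < CARD('n) \<Longrightarrow> e k \<bullet> e l = (if k = l then 1 else 0)"
  shows "A = (\<chi> i j. \<Sum>k<CARD('n). (A *v e k) $ i * e k $ j)"
proof -
  have "A $ i $ j = (\<Sum>k<CARD('n). (A *v e k) $ i * e k $ j)" for i j
  proof -
    have "A $ i $ j = A $ i \<bullet> axis j 1"
      by (simp add: inner_axis)
    also have "\<dots> = (\<Sum>k<CARD('n). (e k \<bullet> axis j 1) * (A $ i \<bullet> e k))"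
      by (subst orthonormal_family_expand[OF on]) (simp_all add: inner_sum_right)
    also have "\<dots> = (\<Sum>k<CARD('n). (A *v e k) $ i * e k $ j)"
      by (simp add: inner_axis matrix_vector_mul_component mult.commute)
    finally show ?thesis .
  qed
  then show ?thesis by (simp add: vec_eq_iff)
qed

text \<open>If a symmetric matrix is given by an orthogonal eigenbasis, flipping the sign of the left
  vectors that belong to negative eigenvalues turns the eigendecomposition into a singular value
  decomposition.  So its polar factor is its matrix sign function, and is determined by
  what it does to the eigenvectors.  The eigenvectors are not normalised, which keeps nested
  square roots out of applications.\<close>

lemma polar_eqI_eigenbasis:
  fixes M P :: "real^'n^'n" and w :: "nat \<Rightarrow> real^'n"
  assumes orth: "\<And>k l. k < CARD('n) \<Longrightarrow> l < CARD('n) \<Longrightarrow> k \<noteq> l \<Longrightarrow> w k \<bullet> w l = 0"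
    and nz: "\<And>k. k < CARD('n) \<Longrightarrow> w k \<noteq> 0"
    and ev_nz: "\<And>k. k < CARD('n) \<Longrightarrow> ev k \<noteq> 0"
    and M: "\<And>k. k < CARD('n) \<Longrightarrow> M *v w k = ev k *\<^sub>R w k"
    and P: "\<And>k. k < CARD('n) \<Longrightarrow> P *v w k = sgn (ev k) *\<^sub>R w k"
  shows "polar M = P"
proof -
  define e where "e k = w k /\<^sub>R norm (w k)" for k
  have on: "e k \<bullet> e l = (if k = l then 1 else 0)" if "k < CARD('n)" "l < CARD('n)" for k l
    using orth[OF that] nz[OF that(1)]
    by (auto simp: e_def dot_square_norm power2_eq_square field_simps)
  have Me: "M *v e k = ev k *\<^sub>R e k" and Pe: "P *v e k = sgn (ev k) *\<^sub>R e k"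
    if "k < CARD('n)" for k
    using M[OF that] P[OF that] by (simp_all add: e_def matrix_vector_mult_scaleR)
  have coords: "M *v x = (\<Sum>k<CARD('n). (ev k * (e k \<bullet> x)) *\<^sub>R e k)" for x
  proof -
    have "M *v x = (\<Sum>k<CARD('n). M *v ((e k \<bullet> x) *\<^sub>R e k))"
      by (subst orthonormal_family_expand[OF on, of x])
         (simp_all add: linear_sum[OF matrix_vector_mul_linear])
    then show ?thesis
      by (simp add: matrix_vector_mult_scaleR Me mult.commute)
  qed
  \<comment> \<open>The rank is full: the coordinates of \<open>M *v x\<close> are those of \<open>x\<close> multiplied by nonzero eigenvalues.\<close>
  have "e l \<bullet> (M *v x) = ev l * (e l \<bullet> x)" if "l < CARD('n)" for l x
  proof -
    have "e l \<bullet> (M *v x) = (\<Sum>k<CARD('n). if k = l then ev l * (e l \<bullet> x) else 0)"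
      unfolding coords inner_sum_right using on that by (intro sum.cong) auto
    with that show ?thesis by simp
  qed
  then have "e l \<bullet> x = 0" if "M *v x = 0" "l < CARD('n)" for l x
    using that ev_nz by (metis inner_zero_right mult_eq_0_iff)
  then have "x = 0" if "M *v x = 0" for x
    using that by (subst orthonormal_family_expand[OF on, of x]) simp_all
  then have rank: "rank M = CARD('n)"
    by (meson full_rank_injective matrix_left_invertible_injective matrix_left_invertible_ker)
  have "thin_svd M CARD('n) (\<lambda>k. sgn (ev k) *\<^sub>R e k) (\<lambda>k. \<bar>ev k\<bar>) e"
    unfolding thin_svd_def
  proof (intro conjI allI impI)
    show "M = (\<chi> i j. \<Sum>k<CARD('n). (sgn (ev k) *\<^sub>R e k) $ i * \<bar>ev k\<bar> * e k $ j)"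
    proof -
      have "(M *v e k) $ i = (sgn (ev k) *\<^sub>R e k) $ i * \<bar>ev k\<bar>" if "k < CARD('n)" for i k
        using that by (simp add: Me sgn_if)
      then have "(\<chi> i j. \<Sum>k<CARD('n). (M *v e k) $ i * e k $ j) =
          (\<chi> i j. \<Sum>k<CARD('n). (sgn (ev k) *\<^sub>R e k) $ i * \<bar>ev k\<bar> * e k $ j)"
        by (simp add: vec_eq_iff)
      with matrix_eq_sum_orthonormal_family[OF on, where A = M] show ?thesis
        by (rule trans)
    qed
  next
    fix k l assume "k < CARD('n)" "l < CARD('n)"
    then show "sgn (ev k) *\<^sub>R e k \<bullet> sgn (ev l) *\<^sub>R e l = (if k = l then 1 else 0)"
      using on ev_nz by (auto simp: sgn_if)
  qed (use rank on ev_nz in auto)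
  then have "polar M = (\<chi> i j. \<Sum>k<CARD('n). (sgn (ev k) *\<^sub>R e k) $ i * e k $ j)"
    by (rule polar_eq)
  also have "\<dots> = (\<chi> i j. \<Sum>k<CARD('n). (P *v e k) $ i * e k $ j)"
    by (simp add: vec_eq_iff Pe)
  also have "\<dots> = P"
    by (rule matrix_eq_sum_orthonormal_family[OF on, where A = P, symmetric])
  finally show ?thesis .
qed

section \<open>Signs and the MuonSign iteration on a linear objective\<close>

lemma is_sign_unique:
  assumes "is_sign M S" "is_sign M S'" "\<And>i j. M $ i $ j \<noteq> 0"
  shows "S = S'"
  using assms unfolding is_sign_def vec_eq_iff by (metis linorder_neqE_linordered_idom)

lemma is_sign_scaleR:
  assumes "c > 0"
  shows "is_sign (c *\<^sub>R M) S \<longleftrightarrow> is_sign M S"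
  using assms by (simp add: is_sign_def zero_less_mult_iff mult_less_0_iff)

lemma inner_matrix_eq_trace:
  fixes A B :: "real^'n^'m"
  shows "A \<bullet> B = trace (transpose A ** B)"
  unfolding inner_matrix_eq_sum trace_def matrix_matrix_mult_def transpose_def
  by simp (rule sum.swap)

lemma GDERIV_linear:
  assumes "GDERIV (\<lambda>Y. G \<bullet> Y) X :> D"
  shows "D = G"
proof -
  have "((\<lambda>Y. G \<bullet> Y) has_derivative (\<lambda>h. h \<bullet> G)) (at X)"
    by (auto intro!: derivative_eq_intros simp: inner_commute)
  with assms have "(\<lambda>h. h \<bullet> D) = (\<lambda>h. h \<bullet> G)"
    unfolding gderiv_def by (rule has_derivative_unique)
  then show ?thesis
    by (metis inner_commute vector_eq_ldot)
qed

text \<open>On a linear objective the gradient is constant, so both momentum buffers are positive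
  multiples of it from the first step on.  The sign forgets the multiple: every step is one
  that the gradient itself could give, and moves the objective by \<open>- \<eta> (G \<bullet> s)\<close>.\<close>

lemma muon_sign_run_ascends:
  fixes G :: "real^'n^'m"
  assumes desc: "\<And>S s. is_sign G S \<Longrightarrow> is_sign (polar S) s \<Longrightarrow> G \<bullet> s < 0"
    and run: "muon_sign_run variant (\<lambda>Y. G \<bullet> Y) \<mu> \<eta> X0 X"
    and \<mu>: "0 \<le> \<mu>" "\<mu> < 1" and \<eta>: "\<eta> t > 0" and t: "t \<ge> 1"
  shows "G \<bullet> X t > G \<bullet> X (t - 1)"
proof -
  from run obtain D M Mt S s where M0: "M 0 = 0"
    and step: "\<And>t. t \<ge> 1 \<Longrightarrow>
           (GDERIV (\<lambda>Y. G \<bullet> Y) (X (t - 1)) :> D t) \<and>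
           M t = \<mu> *\<^sub>R M (t - 1) + (1 - \<mu>) *\<^sub>R D t \<and>
           Mt t = (case variant of
                     Standard \<Rightarrow> M t
                   | Nesterov \<Rightarrow> (1 - \<mu>) *\<^sub>R D t + \<mu> *\<^sub>R M t) \<and>
           is_sign (Mt t) (S t) \<and>
           is_sign (polar (S t)) (s t) \<and>
           X t = X (t - 1) - \<eta> t *\<^sub>R s t"
    unfolding muon_sign_run_def by blast
  have D: "D t = G" if "t \<ge> 1" for t
    using step[OF that] GDERIV_linear by blast
  have M: "M t = (1 - \<mu> ^ t) *\<^sub>R G" for t
  proof (induction t)
    case (Suc t)
    have "M (Suc t) = \<mu> *\<^sub>R M t + (1 - \<mu>) *\<^sub>R G"
      using step[of "Suc t"] D[of "Suc t"] by simp
    also have "\<dots> = (1 - \<mu> ^ Suc t) *\<^sub>R G"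
      unfolding Suc.IH by (simp add: algebra_simps)
    finally show ?case .
  qed (simp add: M0)
  have pos: "1 - \<mu> ^ t > 0"
    using \<mu> t by (simp add: power_less_one_iff)
  have "\<exists>c>0. Mt t = c *\<^sub>R G"
  proof (cases variant)
    case Standard
    then have "Mt t = (1 - \<mu> ^ t) *\<^sub>R G"
      using step[OF t] M by simp
    with pos show ?thesis by blast
  next
    case Nesterov
    then have "Mt t = ((1 - \<mu>) + \<mu> * (1 - \<mu> ^ t)) *\<^sub>R G"
      using step[OF t] M D[OF t] by (simp add: scaleR_left_distrib)
    moreover have "(1 - \<mu>) + \<mu> * (1 - \<mu> ^ t) > 0"
      using \<mu> pos by (simp add: add_pos_nonneg)
    ultimately show ?thesis by blast
  qed
  then have "is_sign G (S t)"
    using step[OF t] is_sign_scaleR by metis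
  then have "G \<bullet> s t < 0"
    using step[OF t] desc by blast
  moreover have "G \<bullet> X t = G \<bullet> X (t - 1) - \<eta> t * (G \<bullet> s t)"
    using step[OF t] by (simp add: inner_diff_right)
  ultimately show ?thesis
    using \<eta> by (simp add: mult_pos_neg)
qed

section \<open>The five-by-five example\<close>

lemma exhaust_5:
  fixes x :: 5
  shows "x = 1 \<or> x = 2 \<or> x = 3 \<or> x = 4 \<or> x = 5"
proof (induct x)
  case (of_int z)
  then have "z = 0 \<or> z = 1 \<or> z = 2 \<or> z = 3 \<or> z = 4" by fastforce
  then show ?case by auto
qed

lemma forall_5: "(\<forall>i::5. P i) \<longleftrightarrow> P 1 \<and> P 2 \<and> P 3 \<and> P 4 \<and> P 5"
  by (metis exhaust_5)

lemma UNIV_5: "UNIV = {1, 2, 3, 4, 5::5}"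
  using exhaust_5 by auto

lemma sum_5: "sum f (UNIV::5 set) = f 1 + f 2 + f 3 + f 4 + f 5"
  unfolding UNIV_5 by (simp add: ac_simps)

text \<open>The matrices of the example are invariant under permutations of the indices other than
  \<open>1\<close>, so four numbers describe them: the corner, the border, and the diagonal and the
  off-diagonal entries of the remaining four-by-four block.\<close>

definition bordered :: "real \<Rightarrow> real \<Rightarrow> real \<Rightarrow> real \<Rightarrow> real^5^5" where
  "bordered a b c d =
     (\<chi> i j. if i = 1 \<and> j = 1 then a else if i = 1 \<or> j = 1 then b else if i = j then c else d)"

lemma inner_bordered:
  "bordered a b c d \<bullet> bordered a' b' c' d' = a * a' + 8 * (b * b') + 4 * (c * c') + 12 * (d * d')"
  by (simp add: inner_matrix_eq_sum sum_5 bordered_def)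

lemma is_sign_bordered:
  assumes "a \<noteq> 0" "b \<noteq> 0" "c \<noteq> 0" "d \<noteq> 0"
  shows "is_sign (bordered a b c d) S \<longleftrightarrow> S = bordered (sgn a) (sgn b) (sgn c) (sgn d)"
proof -
  have "is_sign (bordered a b c d) (bordered (sgn a) (sgn b) (sgn c) (sgn d))"
    using assms by (auto simp: is_sign_def bordered_def sgn_if)
  moreover have "bordered a b c d $ i $ j \<noteq> 0" for i j
    using assms by (simp add: bordered_def)
  ultimately show ?thesis
    using is_sign_unique by metis
qed

text \<open>An eigenbasis of \<open>bordered 1 1 (-1) 1\<close>.  The first two vectors are constant off the corner;
  on those the eigenvalue equation reduces to \<open>\<lambda>\<^sup>2 - 3 \<lambda> - 2 = 0\<close> with corner entry \<open>2 (\<lambda> - 2)\<close>.  The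
  other three are the nonconstant rows of a four-by-four Hadamard matrix, which makes them
  orthogonal without any roots.\<close>

definition eigvec :: "nat \<Rightarrow> real^5" where
  "eigvec k = (\<chi> i. [[sqrt 17 - 1, 2, 2, 2, 2], [- sqrt 17 - 1, 2, 2, 2, 2],
      [0, 1, 1, -1, -1], [0, 1, -1, 1, -1], [0, 1, -1, -1, 1]] ! k !
      (if i = 1 then 0 else if i = 2 then 1 else if i = 3 then 2 else if i = 4 then 3 else 4))"

definition eigval :: "nat \<Rightarrow> real" where
  "eigval k = [(3 + sqrt 17) / 2, (3 - sqrt 17) / 2, -2, -2, -2] ! k"

lemma all_less_5: "(\<forall>k<5::nat. Q k) \<longleftrightarrow> Q 0 \<and> Q 1 \<and> Q 2 \<and> Q 3 \<and> Q 4"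
  by (simp add: eval_nat_numeral less_Suc_eq) blast

lemma polar_bordered:
  "polar (bordered 1 1 (-1) 1) =
     bordered (- 1 / sqrt 17) (2 / sqrt 17) (1 / (4 * sqrt 17) - 3 / 4) (1 / (4 * sqrt 17) + 1 / 4)"
  (is "polar ?S = ?P")
proof -
  define q where "q = sqrt 17"
  \<comment> \<open>The second eigenvalue \<open>(3 - q) / 2\<close> is negative because \<open>q > 3\<close>.\<close>
  have q2: "q * q = 17" and q4: "q > 4"
    by (simp_all add: q_def real_less_rsqrt)
  have q3: "q > 3" "q \<noteq> 0" using q4 by auto
  have orth: "\<forall>k<5. \<forall>l<5. k \<noteq> l \<longrightarrow> eigvec k \<bullet> eigvec l = 0"
    unfolding all_less_5 by (simp add: eigvec_def inner_vec_def sum_5 algebra_simps)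
  have nz: "\<forall>k<5. eigvec k \<noteq> 0"
    unfolding all_less_5 by (simp add: eigvec_def vec_eq_iff forall_5)
  have ev: "\<forall>k<5. eigval k \<noteq> 0"
    unfolding all_less_5 using q3 by (simp add: eigval_def flip: q_def)
  have M: "\<forall>k<5. ?S *v eigvec k = eigval k *\<^sub>R eigvec k"
    unfolding all_less_5 using q2 q3
    by (simp add: eigvec_def eigval_def vec_eq_iff forall_5 matrix_vector_mult_def sum_5
        bordered_def field_simps flip: q_def)
  have P: "\<forall>k<5. ?P *v eigvec k = sgn (eigval k) *\<^sub>R eigvec k"
    unfolding all_less_5 using q2 q3
    by (simp add: eigvec_def eigval_def vec_eq_iff forall_5 matrix_vector_mult_def sum_5
        bordered_def field_simps flip: q_def)
  show ?thesis
    by (rule polar_eqI_eigenbasis[where w = eigvec and ev = eigval]) (use orth nz ev M P in auto)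
qed

theorem theorem3:
  shows "\<exists>G :: real^5^5.
    (\<forall>S. is_sign G S \<longrightarrow>
       \<bar>G \<bullet> polar S - (-13.89)\<bar> < 0.005 \<and> G \<bullet> polar S < 0 \<and>
       (\<forall>s. is_sign (polar S) s \<longrightarrow> G \<bullet> s = -76)) \<and>
    (\<forall>X. G \<bullet> X = trace (transpose G ** X)) \<and>
    (\<forall>variant X0 \<eta> \<mu> X.
       (\<forall>t\<ge>1. \<eta> t > 0) \<longrightarrow> 0 \<le> \<mu> \<longrightarrow> \<mu> < 1 \<longrightarrow>
       muon_sign_run variant (\<lambda>Y. G \<bullet> Y) \<mu> \<eta> X0 X \<longrightarrow>
       (\<forall>t\<ge>1. G \<bullet> X t > G \<bullet> X (t - 1)))"
proof -
  define G where "G = bordered 100 1 (-1) 1"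
  define q where "q = sqrt 17"
  have q: "q * q = 17" "4.1231 < q" "q < 4.1232"
    unfolding q_def
    by (simp, rule real_less_rsqrt, simp add: power2_eq_square,
        rule real_less_lsqrt, simp_all add: power2_eq_square)
  have signG: "S = bordered 1 1 (-1) 1" if "is_sign G S" for S
    using that by (simp add: G_def is_sign_bordered)
  \<comment> \<open>The factors \<open>8\<close>, \<open>4\<close> and \<open>12\<close> count the border, diagonal and off-diagonal entries.\<close>
  have inner: "G \<bullet> polar S = 6 - 82 / q" if "is_sign G S" for S
  proof -
    have "G \<bullet> polar S = 100 * (- 1 / q) + 8 * (1 * (2 / q))
        + 4 * (- 1 * (1 / (4 * q) - 3 / 4)) + 12 * (1 * (1 / (4 * q) + 1 / 4))"
      unfolding signG[OF that] G_def polar_bordered inner_bordered q_def by (rule refl)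
    also have "\<dots> = 6 - 82 / q"
      using q(2) by (simp add: divide_simps)
    finally show ?thesis .
  qed
  have bounds: "82 / q < 19.895" "82 / q > 19.885"
    using q by (simp_all add: field_simps)
  have signP: "G \<bullet> s = -76" if "is_sign G S" "is_sign (polar S) s" for S s
  proof -
    have "1 / (4 * q) - 3 / 4 < 0" "1 / (4 * q) + 1 / 4 > 0" "q > 0"
      using q by (simp_all add: field_simps)
    \<comment> \<open>Only the corner differs in sign from \<open>G\<close>.\<close>
    then have "s = bordered (-1) 1 (-1) 1"
      using that(2) by (simp add: signG[OF that(1)] polar_bordered is_sign_bordered flip: q_def)
    then show ?thesis
      by (simp add: G_def inner_bordered)
  qed
  show ?thesis
  proof (intro exI[of _ G] conjI allI impI)
    fix S assume S: "is_sign G S"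
    show "\<bar>G \<bullet> polar S - (-13.89)\<bar> < 0.005" "G \<bullet> polar S < 0"
      using inner[OF S] bounds by (simp_all add: abs_if)
  next
    fix variant X0 \<eta> \<mu> X and t :: nat
    assume "\<forall>t\<ge>1. \<eta> t > 0" "0 \<le> \<mu>" "\<mu> < 1" "t \<ge> 1"
      and run: "muon_sign_run variant (\<lambda>Y. G \<bullet> Y) \<mu> \<eta> X0 X"
    then show "G \<bullet> X t > G \<bullet> X (t - 1)"
      using signP by (intro muon_sign_run_ascends[OF _ run]) fastforce+
  qed (use signP inner_matrix_eq_trace in auto)
qed

end
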